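(* Let $X=\{x_1,\dots,x_n\}$ be a finite set and let $\omega=(\omega_1,\dots,\omega_n)$ satisfy $\omega_j\in(0,1]$ and $\sum_{j=1}^n\omega_j=1$. For $I_1,I_2\in\mathrm{IFS}(X)$ define $$d_{\mathrm{Wu}}(I_1,I_2)=\sum_{j=1}^n\omega_j\sqrt{\tfrac12\Big(L\big(1-\mu_{I_1}(x_j),1-\mu_{I_2}(x_j)\big)+L\big(\nu_{I_1}(x_j),\nu_{I_2}(x_j)\big)\Big)},\qquad L(p,q)=p\log_2\frac{2p}{p+q}+q\log_2\frac{2q}{p+q}.$$ Then: (1) $d_{\mathrm{Wu}}$ is a strict intuitionistic fuzzy distance measure (SIFDisM) on $\mathrm{IFS}(X)$. (2) The function $\mathbf{S}_{\mathrm{Wu}}(I_1,I_2)=1-d_{\mathrm{Wu}}(I_1,I_2)$ is a strict intuitionistic fuzzy similarity measure (SIFSimM) on $\mathrm{IFS}(X)$.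
   Context: $\Theta=\{\langle \mu,\nu\rangle\in[0,1]^2 \mid \mu+\nu\le 1\}$. An intuitionistic fuzzy set (IFS) on $X$ is a map $I:X\to\Theta$, $I(x)=\langle\mu_I(x),\nu_I(x)\rangle$; $\mathrm{IFS}(X)$ is the set of all of them. Convention: in $L(p,q)$ ($p,q\ge 0$), any term whose leading factor is $0$ equals $0$ (including $0\cdot\log_2 0=0\cdot\log_2\frac{0}{0+0}=0$). Order: $I_1\subset I_2$ iff $\mu_{I_1}(x)\le\mu_{I_2}(x)$ and $\nu_{I_1}(x)\ge\nu_{I_2}(x)$ for all $x\in X$; $I_1\subsetneqq I_2$ iff $I_1\subset I_2$ and $I_1\neq I_2$. A map $\mathbf{S}:\mathrm{IFS}(X)\times\mathrm{IFS}(X)\to[0,1]$ is a SIFSimM on $\mathrm{IFS}(X)$ if for all $I_1,I_2,I_3$: (S1) $0\le\mathbf{S}(I_1,I_2)\le1$; (S2) $\mathbf{S}(I_1,I_2)=1$ iff $I_1=I_2$; (S3) $\mathbf{S}(I_1,I_2)=\mathbf{S}(I_2,I_1)$; (S4$'$) if $I_1\subsetneqq I_2\subsetneqq I_3$, then $\mathbf{S}(I_1,I_3)<\mathbf{S}(I_1,I_2)$ and $\mathbf{S}(I_1,I_3)<\mathbf{S}(I_2,I_3)$; (S5) $\mathbf{S}(I_1,I_2)=0$ iff for every $x\in X$, ($I_1(x)=\langle0,1\rangle$ and $I_2(x)=\langle1,0\rangle$) or ($I_1(x)=\langle1,0\rangle$ and $I_2(x)=\langle0,1\rangle$). A map $d:\mathrm{IFS}(X)\times\mathrm{IFS}(X)\to[0,1]$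 is a SIFDisM on $\mathrm{IFS}(X)$ if (D1) $d$ is a distance (metric) on $\mathrm{IFS}(X)$: nonnegative, zero exactly on equal pairs, symmetric, and satisfying the triangle inequality; and (D2) $1-d$ is a SIFSimM on $\mathrm{IFS}(X)$. *)

theory Defs
  imports "HOL-Analysis.Abstract_Metric_Spaces" "HOL-Library.FuncSet"
begin

text \<open>A pair in \<open>Theta\<close> is (membership degree, non-membership degree).\<close>

definition Theta :: "(real \<times> real) set" where
  "Theta = {(m, v). m \<in> {0..1} \<and> v \<in> {0..1} \<and> m + v \<le> 1}"

text \<open>The functions are extensional (\<open>undefined\<close> outside \<open>X\<close>), so that HOL equality of members of
  \<open>IFS X\<close> is equality of maps on \<open>X\<close>.\<close>

definition IFS :: "'a set \<Rightarrow> ('a \<Rightarrow> real \<times> real) set" where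
  "IFS X = X \<rightarrow>\<^sub>E Theta"

abbreviation mu :: "('a \<Rightarrow> real \<times> real) \<Rightarrow> 'a \<Rightarrow> real" where
  "mu I x \<equiv> fst (I x)"

abbreviation nu :: "('a \<Rightarrow> real \<times> real) \<Rightarrow> 'a \<Rightarrow> real" where
  "nu I x \<equiv> snd (I x)"

definition ifs_subset :: "'a set \<Rightarrow> ('a \<Rightarrow> real \<times> real) \<Rightarrow> ('a \<Rightarrow> real \<times> real) \<Rightarrow> bool" where
  "ifs_subset X I J \<longleftrightarrow> (\<forall>x\<in>X. mu I x \<le> mu J x \<and> nu I x \<ge> nu J x)"

definition ifs_psubset :: "'a set \<Rightarrow> ('a \<Rightarrow> real \<times> real) \<Rightarrow> ('a \<Rightarrow> real \<times> real) \<Rightarrow> bool" where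
  "ifs_psubset X I J \<longleftrightarrow> ifs_subset X I J \<and> I \<noteq> J"

definition SIFSimM ::
  "'a set \<Rightarrow> (('a \<Rightarrow> real \<times> real) \<Rightarrow> ('a \<Rightarrow> real \<times> real) \<Rightarrow> real) \<Rightarrow> bool" where
  "SIFSimM X S \<longleftrightarrow>
     (\<forall>I1\<in>IFS X. \<forall>I2\<in>IFS X. 0 \<le> S I1 I2 \<and> S I1 I2 \<le> 1) \<and>
     (\<forall>I1\<in>IFS X. \<forall>I2\<in>IFS X. S I1 I2 = 1 \<longleftrightarrow> I1 = I2) \<and>
     (\<forall>I1\<in>IFS X. \<forall>I2\<in>IFS X. S I1 I2 = S I2 I1) \<and>
     (\<forall>I1\<in>IFS X. \<forall>I2\<in>IFS X. \<forall>I3\<in>IFS X.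
        ifs_psubset X I1 I2 \<and> ifs_psubset X I2 I3 \<longrightarrow>
          S I1 I3 < S I1 I2 \<and> S I1 I3 < S I2 I3) \<and>
     (\<forall>I1\<in>IFS X. \<forall>I2\<in>IFS X. S I1 I2 = 0 \<longleftrightarrow>
        (\<forall>x\<in>X. (I1 x = (0, 1) \<and> I2 x = (1, 0)) \<or> (I1 x = (1, 0) \<and> I2 x = (0, 1))))"

text \<open>The locale \<open>Metric_space\<close> demands nonnegativity and symmetry also for arguments outside its
  carrier; setting the distance to \<open>0\<close> there makes it express that \<open>d\<close>, restricted to \<open>M\<close>,
  is a metric on \<open>M\<close>.\<close>

definition metric_on :: "'b set \<Rightarrow> ('b \<Rightarrow> 'b \<Rightarrow> real) \<Rightarrow> bool" where
  "metric_on M d \<longleftrightarrow> Metric_space M (\<lambda>x y. if x \<in> M \<and> y \<in> M then d x y else 0)"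

lemma metric_on_iff:
  "metric_on M d \<longleftrightarrow>
     (\<forall>x\<in>M. \<forall>y\<in>M. 0 \<le> d x y) \<and>
     (\<forall>x\<in>M. \<forall>y\<in>M. d x y = 0 \<longleftrightarrow> x = y) \<and>
     (\<forall>x\<in>M. \<forall>y\<in>M. d x y = d y x) \<and>
     (\<forall>x\<in>M. \<forall>y\<in>M. \<forall>z\<in>M. d x z \<le> d x y + d y z)"
  (is "_ \<longleftrightarrow> ?R")
proof
  assume "metric_on M d"
  then interpret Metric_space M "\<lambda>x y. if x \<in> M \<and> y \<in> M then d x y else 0"
    unfolding metric_on_def .
  show ?R
  proof (intro conjI ballI)
    fix x y assume xy: "x \<in> M" "y \<in> M"
    show "0 \<le> d x y" using nonneg[of x y] xy by simp
    show "d x y = 0 \<longleftrightarrow> x = y" using zero[of x y] xy by simp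
    show "d x y = d y x" using commute[of x y] xy by (simp only: if_True simp_thms)
    fix z assume "z \<in> M"
    then show "d x z \<le> d x y + d y z" using triangle[of x y z] xy by simp
  qed
next
  assume R: ?R
  show "metric_on M d"
    unfolding metric_on_def
  proof
    fix x y
    show "0 \<le> (if x \<in> M \<and> y \<in> M then d x y else 0)" using R by auto
    have "d x y = d y x" if "x \<in> M" "y \<in> M" using R that by blast
    then show "(if x \<in> M \<and> y \<in> M then d x y else 0) = (if y \<in> M \<and> x \<in> M then d y x else 0)"
      by (cases "x \<in> M \<and> y \<in> M") (simp_all only: if_True if_False simp_thms, auto)
  next
    fix x y assume "x \<in> M" "y \<in> M"
    then show "((if x \<in> M \<and> y \<in> M then d x y else 0) = 0) = (x = y)" using R by simp
  next
    fix x y z assume "x \<in> M" "y \<in> M" "z \<in> M"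
    then show "(if x \<in> M \<and> z \<in> M then d x z else 0)
      \<le> (if x \<in> M \<and> y \<in> M then d x y else 0) + (if y \<in> M \<and> z \<in> M then d y z else 0)"
      using R by simp
  qed
qed

definition SIFDisM ::
  "'a set \<Rightarrow> (('a \<Rightarrow> real \<times> real) \<Rightarrow> ('a \<Rightarrow> real \<times> real) \<Rightarrow> real) \<Rightarrow> bool" where
  "SIFDisM X d \<longleftrightarrow>
     (\<forall>I1\<in>IFS X. \<forall>I2\<in>IFS X. d I1 I2 \<in> {0..1}) \<and>
     metric_on (IFS X) d \<and>
     SIFSimM X (\<lambda>I1 I2. 1 - d I1 I2)"

text \<open>For \<open>p = 0\<close> or \<open>q = 0\<close> the corresponding term is \<open>0\<close>, because its leading factor is
  and \<open>log\<close> and division are total; this is the convention \<open>0 log 0 = 0\<close>.\<close>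

definition L :: "real \<Rightarrow> real \<Rightarrow> real" where
  "L p q = p * log 2 (2 * p / (p + q)) + q * log 2 (2 * q / (p + q))"

definition d_Wu ::
  "'a set \<Rightarrow> ('a \<Rightarrow> real) \<Rightarrow> ('a \<Rightarrow> real \<times> real) \<Rightarrow> ('a \<Rightarrow> real \<times> real) \<Rightarrow> real" where
  "d_Wu X \<omega> I1 I2 =
     (\<Sum>x\<in>X. \<omega> x * sqrt (1 / 2 * (L (1 - mu I1 x) (1 - mu I2 x) + L (nu I1 x) (nu I2 x))))"

definition S_Wu ::
  "'a set \<Rightarrow> ('a \<Rightarrow> real) \<Rightarrow> ('a \<Rightarrow> real \<times> real) \<Rightarrow> ('a \<Rightarrow> real \<times> real) \<Rightarrow> real" where
  "S_Wu X \<omega> I1 I2 = 1 - d_Wu X \<omega> I1 I2"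

end

theory Submission
  imports Defs "HOL-Real_Asymp.Real_Asymp"
begin

text \<open>Everything reduces to the kernel \<open>L\<close> on the nonnegative reals: it is strictly monotone as its
  arguments move apart, it is at most \<open>\<bar>p - q\<bar>\<close>, and its square root satisfies the triangle
  inequality (Endres and Schindelin). A Euclidean combination of two metrics is a metric, and so is
  a positively weighted sum. For \<open>p \<le> r \<le> q\<close> the triangle inequality follows by
  differentiating \<open>sqrt (L p q) - sqrt (L r q)\<close> in \<open>q\<close>, which leads to the one-variable inequality
  \<open>(1 - s) * ln (1 - s) + (1 + s) * ln (1 + s) + ln (1 + s) * ln (1 - s) \<le> 0\<close>
  on \<open>[0, 1)\<close>.\<close>

section \<open>The kernel \<open>J\<close>: continuity and derivative\<close>

text \<open>\<open>L\<close> with natural logarithms, rearranged so that continuity up to \<open>p = 0\<close> follows from that of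
  \<open>x * ln x\<close> (with \<open>ln 0 = 0\<close>).\<close>

definition J :: "real \<Rightarrow> real \<Rightarrow> real" where
  "J p q = p * ln p + q * ln q - (p + q) * ln ((p + q) / 2)"

lemma L_eq_J:
  assumes "0 \<le> p" "0 \<le> q"
  shows "L p q = J p q / ln 2"
proof -
  \<comment> \<open>At \<open>x = 0\<close> the leading factor annihilates both sides; otherwise the
    logarithm of the quotient splits.\<close>
  have *: "x * log 2 (2 * x / (x + y)) = x * (ln x - ln ((x + y) / 2)) / ln 2"
    if "0 \<le> x" "0 \<le> y" for x y :: real
    using that by (cases "x = 0") (auto simp: log_def ln_div ln_mult algebra_simps)
  show ?thesis
    using *[of p q] *[of q p] assms
    by (simp add: L_def J_def add.commute field_simps)
qed

lemma J_commute: "J p q = J q p"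
  by (simp add: J_def add.commute)

lemma J_self [simp]: "J p p = 0"
  by (simp add: J_def)

lemma continuous_on_times_ln: "continuous_on {0..} (\<lambda>x::real. x * ln x)"
proof (unfold continuous_on_eq_continuous_within, rule ballI)
  fix x :: real assume x: "x \<in> {0..}"
  show "continuous (at x within {0..}) (\<lambda>x. x * ln x)"
  proof (cases "x = 0")
    case True
    have "((\<lambda>x::real. x * ln x) \<longlongrightarrow> 0) (at_right 0)"
      by real_asymp
    then show ?thesis
      using True by (simp add: continuous_within at_within_Ici_at_right)
  next
    case False
    then show ?thesis using x by (intro continuous_intros) auto
  qed
qed

lemma continuous_on_J:
  assumes "0 \<le> q" "0 \<le> a"
  shows "continuous_on {a..b} (J q)"
proof -
  have c: "continuous_on {a..b} (\<lambda>x. f x * ln (f x))"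
    if "continuous_on {a..b} f" "f ` {a..b} \<subseteq> {0..}" for f :: "real \<Rightarrow> real"
    using continuous_on_compose2[OF continuous_on_times_ln that] .
  \<comment> \<open>Taking out the factor 2 gives the midpoint term the shape
    \<open>f t * ln (f t)\<close>, so \<open>c\<close> covers the endpoint 0 as well.\<close>
  have "continuous_on {a..b} (\<lambda>t. q * ln q + t * ln t - 2 * (((q + t) / 2) * ln ((q + t) / 2)))"
    using assms by (intro continuous_intros c) auto
  then show ?thesis
    by (simp add: J_def[abs_def] algebra_simps add_divide_distrib)
qed

text \<open>The constants 1 from \<open>t * ln t\<close> and from the midpoint term cancel, leaving
  a difference of logarithms.\<close>

lemma DERIV_J:
  assumes "0 \<le> p" "0 < t"
  shows "(J p has_real_derivative ln (2 * t / (p + t))) (at t)"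
proof -
  have pt: "0 < p + t" using assms by simp
  have D: "((\<lambda>t. ln ((p + t) / 2)) has_real_derivative 1 / (p + t)) (at t)"
    using pt by (auto intro!: derivative_eq_intros simp: divide_simps)
  have "((\<lambda>t. p * ln p + t * ln t - (p + t) * ln ((p + t) / 2)) has_real_derivative
      ln t - ln ((p + t) / 2)) (at t)"
    by (rule DERIV_cong, (rule D DERIV_ln_divide[OF assms(2)] derivative_intros)+) (use pt assms in auto)
  also have "ln t - ln ((p + t) / 2) = ln (2 * t / (p + t))"
    using pt assms by (simp add: ln_div ln_mult)
  finally show ?thesis by (simp add: J_def[abs_def])
qed

section \<open>Monotonicity and a linear upper bound for \<open>J\<close>\<close>

lemma J_less_right:
  assumes "0 \<le> p" "p \<le> r" "r < q"
  shows "J p r < J p q"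
proof (rule DERIV_pos_imp_increasing_open[OF assms(3)])
  fix t assume t: "r < t" "t < q"
  have "1 < 2 * t / (p + t)" using t assms by (simp add: field_simps)
  then have "0 < ln (2 * t / (p + t))" by simp
  then show "\<exists>y. (J p has_real_derivative y) (at t) \<and> 0 < y"
    using DERIV_J[of p t] t assms by auto
qed (use assms in \<open>auto intro: continuous_on_J\<close>)

lemma J_less_left:
  assumes "0 \<le> p" "p < r" "r \<le> q"
  shows "J r q < J p q"
proof -
  \<comment> \<open>Symmetry moves the varying argument to the second place, where
    \<open>DERIV_J\<close> applies; below \<open>q\<close> the slope is negative.\<close>
  have "J q r < J q p"
  proof (rule DERIV_neg_imp_decreasing_open[OF assms(2)])
    fix t assume t: "p < t" "t < r"
    have "2 * t / (q + t) < 1" "0 < 2 * t / (q + t)" using t assms by (simp_all add: field_simps)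
    then have "ln (2 * t / (q + t)) < 0" by (simp add: ln_less_zero)
    then show "\<exists>y. (J q has_real_derivative y) (at t) \<and> y < 0"
      using DERIV_J[of q t] t assms by auto
  qed (use assms in \<open>auto intro: continuous_on_J\<close>)
  then show ?thesis by (simp add: J_commute)
qed

lemma J_pos: "0 \<le> p \<Longrightarrow> p < q \<Longrightarrow> 0 < J p q"
  using J_less_right[of p p q] by simp

lemma J_nonneg: "0 \<le> p \<Longrightarrow> 0 \<le> q \<Longrightarrow> 0 \<le> J p q"
  using J_pos[of p q] J_pos[of q p] J_commute[of p q] by (cases p q rule: linorder_cases) auto

text \<open>Both sides vanish at \<open>q = p\<close>, and the slope in \<open>q\<close> is at most
  \<open>ln 2\<close> because \<open>2 * t / (p + t)\<close> is at most 2.\<close>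

lemma J_upper:
  assumes "0 \<le> p" "p \<le> q"
  shows "J p q \<le> (q - p) * ln 2"
proof -
  have "(\<lambda>t. J p t - (t - p) * ln 2) q \<le> (\<lambda>t. J p t - (t - p) * ln 2) p"
  proof (rule DERIV_nonpos_imp_decreasing_open[OF assms(2)])
    fix t assume t: "p < t" "t < q"
    have "2 * t / (p + t) \<le> 2" using t assms by (simp add: field_simps)
    then have "ln (2 * t / (p + t)) \<le> ln 2"
      using t assms by (subst ln_le_cancel_iff) auto
    moreover have "((\<lambda>t. J p t - (t - p) * ln 2) has_real_derivative ln (2 * t / (p + t)) - ln 2) (at t)"
      using t assms by (auto intro!: derivative_eq_intros DERIV_J)
    ultimately show "\<exists>y. ((\<lambda>t. J p t - (t - p) * ln 2) has_real_derivative y) (at t) \<and> y \<le> 0"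
      by auto
  qed (use assms in \<open>auto intro!: continuous_intros continuous_on_J\<close>)
  then show ?thesis by simp
qed

section \<open>The triangle inequality for the square root of \<open>J\<close>\<close>

text \<open>This is \<open>J (1 - s) (1 + s)\<close>: the midpoint is 1, so its logarithm
  vanishes.\<close>

lemma entropy_pair_nonneg:
  fixes s :: real
  assumes "0 \<le> s" "s < 1"
  shows "0 \<le> (1 - s) * ln (1 - s) + (1 + s) * ln (1 + s)"
  using J_nonneg[of "1 - s" "1 + s"] assms by (simp add: J_def)

text \<open>With \<open>K s = (1 - s) * ln (1 - s) + (1 + s) * ln (1 + s)\<close>, the left-hand side has
  derivative \<open>- s / (1 - s\<^sup>2) * K s\<close>.\<close>

lemma entropy_pair_le:
  fixes s :: real
  assumes "0 \<le> s" "s < 1"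
  shows "(1 - s) * ln (1 - s) + (1 + s) * ln (1 + s) + ln (1 + s) * ln (1 - s) \<le> 0"
proof -
  define F where "F = (\<lambda>s::real. (1 - s) * ln (1 - s) + (1 + s) * ln (1 + s) + ln (1 + s) * ln (1 - s))"
  have "F s \<le> F 0"
  proof (rule DERIV_nonpos_imp_decreasing_open[OF assms(1)])
    fix t assume t: "0 < t" "t < s"
    have sq: "1 - t\<^sup>2 = (1 - t) * (1 + t)" by (simp add: power2_eq_square algebra_simps)
    have t1: "0 < 1 + t" "0 < 1 - t" using t assms by simp_all
    have D: "((\<lambda>t. ln (1 + t)) has_real_derivative 1 / (1 + t)) (at t)"
      "((\<lambda>t. ln (1 - t)) has_real_derivative - 1 / (1 - t)) (at t)"
      using t1 by (auto intro!: derivative_eq_intros)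
    have "(F has_real_derivative
        ln (1 + t) - ln (1 - t) + (ln (1 - t) / (1 + t) - ln (1 + t) / (1 - t))) (at t)"
      unfolding F_def
      by (rule DERIV_cong, (rule D derivative_intros)+) (use t1 in auto)
    also have "ln (1 + t) - ln (1 - t) + (ln (1 - t) / (1 + t) - ln (1 + t) / (1 - t))
        = - t / (1 - t\<^sup>2) * ((1 - t) * ln (1 - t) + (1 + t) * ln (1 + t))"
      unfolding sq using t assms by (simp add: divide_simps) (simp add: algebra_simps)
    finally have D: "(F has_real_derivative
      - t / (1 - t\<^sup>2) * ((1 - t) * ln (1 - t) + (1 + t) * ln (1 + t))) (at t)" .
    have "0 < 1 - t\<^sup>2" unfolding sq using t assms by simp
    then have "- t / (1 - t\<^sup>2) \<le> 0" using t by (simp add: divide_le_0_iff)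
    then have "- t / (1 - t\<^sup>2) * ((1 - t) * ln (1 - t) + (1 + t) * ln (1 + t)) \<le> 0"
      using entropy_pair_nonneg[of t] t assms by (intro mult_nonpos_nonneg) auto
    with D show "\<exists>y. (F has_real_derivative y) (at t) \<and> y \<le> 0" by blast
  qed (use assms in \<open>auto simp: F_def intro!: continuous_intros\<close>)
  then show ?thesis by (simp add: F_def)
qed

text \<open>Substituting \<open>s = (q - p) / (p + q)\<close> makes \<open>1 + s = 2 * q / (p + q)\<close> and
  \<open>1 - s = 2 * p / (p + q)\<close>.\<close>

lemma J_le_ln_mult_ln:
  assumes "0 < p" "p \<le> q"
  shows "2 * J p q / (p + q) + ln (2 * q / (p + q)) * ln (2 * p / (p + q)) \<le> 0"
proof -
  define s where "s = (q - p) / (p + q)"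
  have s: "0 \<le> s" "s < 1" "1 + s = 2 * q / (p + q)" "1 - s = 2 * p / (p + q)"
    using assms by (auto simp: s_def field_simps)
  have "J p q = p * ln (2 * p / (p + q)) + q * ln (2 * q / (p + q))"
    using assms by (simp add: J_def ln_div ln_mult algebra_simps)
  then have "2 * J p q / (p + q) = (1 - s) * ln (1 - s) + (1 + s) * ln (1 + s)"
    unfolding s by (simp add: add_divide_distrib distrib_left mult.assoc)
  then show ?thesis using entropy_pair_le[OF s(1,2)] by (simp add: s)
qed

text \<open>The two sides are four times the squared derivatives in \<open>q\<close> of
  \<open>sqrt (J p q)\<close> and \<open>sqrt (J r q)\<close>, so this compares slopes.\<close>

lemma ln_ratio_J_mono:
  assumes "0 \<le> p" "p \<le> r" "r < q"
  shows "(ln (2 * q / (p + q)))\<^sup>2 / J p q \<le> (ln (2 * q / (r + q)))\<^sup>2 / J r q"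
proof -
  \<comment> \<open>The fixed \<open>q\<close> comes first in \<open>J q t\<close> so that
    \<open>DERIV_J\<close> differentiates in \<open>t\<close>.\<close>
  define G where "G = (\<lambda>t. (ln (2 * q / (q + t)))\<^sup>2 / J q t)"
  have pos: "0 < J q t" if "p \<le> t" "t \<le> r" for t
    using J_pos[of t q] that assms by (simp add: J_commute)
  have "G p \<le> G r"
  proof (rule DERIV_nonneg_imp_increasing_open[OF assms(2)])
    fix t assume t: "p < t" "t < r"
    define u where "u = ln (2 * q / (q + t))"
    define v where "v = ln (2 * t / (q + t))"
    have u: "0 \<le> u" unfolding u_def using t assms by (simp add: field_simps)
    have Du: "((\<lambda>t. ln (2 * q / (q + t))) has_real_derivative - 1 / (q + t)) (at t)"
    proof -
      have "0 < q" "0 < q + t" using t assms by simp_all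
      then show ?thesis
        by (auto intro!: derivative_eq_intros simp: divide_simps power2_eq_square)
    qed
    have DJ: "(J q has_real_derivative v) (at t)"
      unfolding v_def using DERIV_J[of q t] t assms by simp
    have "(G has_real_derivative
        ((2 * u * (- 1 / (q + t))) * J q t - u\<^sup>2 * v) / (J q t * J q t)) (at t)"
      unfolding G_def
      by (rule DERIV_cong, (rule Du DJ derivative_intros)+) (use pos[of t] t in \<open>auto simp: u_def\<close>)
    \<comment> \<open>Factoring out \<open>- u\<close> isolates the left-hand side of
      \<open>J_le_ln_mult_ln\<close>; both factors are nonpositive.\<close>
    moreover have "(2 * u * (- 1 / (q + t))) * J q t - u\<^sup>2 * v
        = - u * (2 * J t q / (t + q) + u * v)"
      by (simp add: J_commute[of q t] power2_eq_square algebra_simps)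
    moreover have "2 * J t q / (t + q) + u * v \<le> 0"
      unfolding u_def v_def using J_le_ln_mult_ln[of t q] t assms by (simp add: add.commute)
    then have "0 \<le> - u * (2 * J t q / (t + q) + u * v) / (J q t * J q t)"
      using u by (intro divide_nonneg_nonneg zero_le_square) (intro mult_nonpos_nonpos, auto)
    ultimately show "\<exists>y. (G has_real_derivative y) (at t) \<and> 0 \<le> y" by metis
  next
    show "continuous_on {p..r} G"
    proof -
      have "q + t \<noteq> 0" "J q t \<noteq> 0" if "t \<in> {p..r}" for t
        using pos[of t] that assms by auto
      moreover from this have "2 * q / (q + t) \<noteq> 0" if "t \<in> {p..r}" for t
        using that assms by auto
      ultimately show ?thesis
        unfolding G_def using assms by (intro continuous_intros continuous_on_J) auto
    qed
  qed
  then show ?thesis by (simp add: G_def J_commute[of q] add.commute)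
qed

text \<open>The triangle inequality holds with equality at \<open>q = r\<close>, and \<open>ln_ratio_J_mono\<close> says
  exactly that \<open>sqrt (J p q) - sqrt (J r q)\<close> does not increase with \<open>q\<close>.\<close>

lemma sqrt_J_triangle_ordered:
  assumes "0 \<le> p" "p \<le> r" "r \<le> q"
  shows "sqrt (J p q) \<le> sqrt (J p r) + sqrt (J r q)"
proof -
  have "(\<lambda>t. sqrt (J p t) - sqrt (J r t)) q \<le> (\<lambda>t. sqrt (J p t) - sqrt (J r t)) r"
  proof (rule DERIV_nonpos_imp_decreasing_open[OF assms(3)])
    fix t assume t: "r < t" "t < q"
    define a where "a = ln (2 * t / (p + t))"
    define b where "b = ln (2 * t / (r + t))"
    have pos: "0 < J p t" "0 < J r t" using J_pos t assms by auto
    have ab: "0 \<le> a" "0 \<le> b" unfolding a_def b_def using t assms by (simp_all add: field_simps)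
    \<comment> \<open>As \<open>a\<close> and \<open>b\<close> are nonnegative, taking roots
      recovers the slopes themselves, up to the factor 1/2.\<close>
    have "sqrt (a\<^sup>2 / J p t) \<le> sqrt (b\<^sup>2 / J r t)"
      unfolding a_def b_def using ln_ratio_J_mono[of p r t] t assms by simp
    then have le: "a / sqrt (J p t) \<le> b / sqrt (J r t)"
      using ab by (simp add: real_sqrt_divide)
    have "((\<lambda>t. sqrt (J p t) - sqrt (J r t)) has_real_derivative
        (a / sqrt (J p t) - b / sqrt (J r t)) / 2) (at t)"
      using pos DERIV_J[of p t] DERIV_J[of r t] t assms unfolding a_def b_def
      by (auto intro!: derivative_eq_intros simp: field_simps)
    with le show "\<exists>y. ((\<lambda>t. sqrt (J p t) - sqrt (J r t)) has_real_derivative y) (at t) \<and> y \<le> 0"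
      by (intro exI conjI) auto
  qed (use assms in \<open>auto intro!: continuous_intros continuous_on_J\<close>)
  then show ?thesis by simp
qed

lemma sqrt_J_triangle:
  assumes "0 \<le> p" "0 \<le> q" "0 \<le> r"
  shows "sqrt (J p q) \<le> sqrt (J p r) + sqrt (J r q)"
proof -
  \<comment> \<open>By symmetry it suffices to treat \<open>p \<le> q\<close>. If \<open>r\<close>
    lies outside \<open>[p, q]\<close>, monotonicity makes one summand alone dominate.\<close>
  have ordered: "sqrt (J p q) \<le> sqrt (J p r) + sqrt (J r q)"
    if "0 \<le> p" "p \<le> q" "0 \<le> r" for p q r
  proof (cases "r < p")
    case True
    have "sqrt (J p q) \<le> sqrt (J r q)"
      using J_less_left[of r p q] True that by simp
    then show ?thesis using J_nonneg[of p r] that by (simp add: add_increasing)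
  next
    case False
    show ?thesis
    proof (cases "q < r")
      case True
      have "sqrt (J p q) \<le> sqrt (J p r)"
        using J_less_right[of p q r] True that by simp
      then show ?thesis using J_nonneg[of r q] that by (simp add: add_increasing2)
    next
      case False
      then show ?thesis using sqrt_J_triangle_ordered[of p r q] \<open>\<not> r < p\<close> that by simp
    qed
  qed
  show ?thesis
    using ordered[of p q r] ordered[of q p r] assms J_commute[of p q] J_commute[of p r] J_commute[of r q]
    by (cases "p \<le> q") auto
qed

section \<open>Transfer of the properties of \<open>J\<close> to \<open>L\<close>\<close>

lemma L_commute: "L p q = L q p"
  by (simp add: L_def add.commute)

lemma L_nonneg: "0 \<le> p \<Longrightarrow> 0 \<le> q \<Longrightarrow> 0 \<le> L p q"
  by (simp add: L_eq_J J_nonneg)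

lemma L_eq_0_iff: "0 \<le> p \<Longrightarrow> 0 \<le> q \<Longrightarrow> L p q = 0 \<longleftrightarrow> p = q"
  using J_pos[of p q] J_pos[of q p] J_commute[of p q]
  by (cases p q rule: linorder_cases) (auto simp: L_eq_J)

lemma L_le_abs_diff:
  assumes "0 \<le> p" "0 \<le> q"
  shows "L p q \<le> \<bar>p - q\<bar>"
  using J_upper[of p q] J_upper[of q p] J_commute[of p q] assms
  by (cases "p \<le> q") (auto simp: L_eq_J field_simps)

lemma sqrt_L_triangle:
  assumes "0 \<le> p" "0 \<le> q" "0 \<le> r"
  shows "sqrt (L p q) \<le> sqrt (L p r) + sqrt (L r q)"
  using sqrt_J_triangle[OF assms] assms
  by (simp add: L_eq_J real_sqrt_divide add_divide_distrib[symmetric] divide_right_mono)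

lemma L_less_right: "0 \<le> p \<Longrightarrow> p \<le> r \<Longrightarrow> r < q \<Longrightarrow> L p r < L p q"
  by (simp add: L_eq_J J_less_right divide_strict_right_mono)

lemma L_less_left: "0 \<le> p \<Longrightarrow> p < r \<Longrightarrow> r \<le> q \<Longrightarrow> L r q < L p q"
  by (simp add: L_eq_J J_less_left divide_strict_right_mono)

section \<open>The metric \<open>D\<close> on \<open>Theta\<close>, the contribution of a single
  point of \<open>X\<close>\<close>

definition D :: "real \<times> real \<Rightarrow> real \<times> real \<Rightarrow> real" where
  "D a b = sqrt (1 / 2 * (L (1 - fst a) (1 - fst b) + L (snd a) (snd b)))"

lemma Theta_bounds:
  assumes "a \<in> Theta"
  shows "0 \<le> fst a" "fst a \<le> 1" "0 \<le> snd a" "snd a \<le> 1" "fst a + snd a \<le> 1"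
  using assms by (auto simp: Theta_def)

lemma D_commute: "D a b = D b a"
  by (simp add: D_def L_commute)

lemma D_nonneg:
  assumes "a \<in> Theta" "b \<in> Theta"
  shows "0 \<le> D a b"
  using assms[THEN Theta_bounds(2)] assms[THEN Theta_bounds(3)] by (simp add: D_def L_nonneg)

lemma D_eq_0_iff:
  assumes "a \<in> Theta" "b \<in> Theta"
  shows "D a b = 0 \<longleftrightarrow> a = b"
  using assms[THEN Theta_bounds(2)] assms[THEN Theta_bounds(3)]
  by (simp add: D_def add_nonneg_eq_0_iff L_nonneg L_eq_0_iff prod_eq_iff)

lemma D_le_1:
  assumes "a \<in> Theta" "b \<in> Theta"
  shows "D a b \<le> 1"
  using L_le_abs_diff[of "1 - fst a" "1 - fst b"] L_le_abs_diff[of "snd a" "snd b"]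
    Theta_bounds[OF assms(1)] Theta_bounds[OF assms(2)]
  by (simp add: D_def)

text \<open>Since \<open>L\<close> is at most the absolute difference, value 1 forces both
  coordinates to differ by a full 1. The constraint of \<open>Theta\<close> excludes
  \<open>(1, 1)\<close>, which leaves only the two crisp opposites.\<close>

lemma D_eq_1_iff:
  assumes "a \<in> Theta" "b \<in> Theta"
  shows "D a b = 1 \<longleftrightarrow> a = (0, 1) \<and> b = (1, 0) \<or> a = (1, 0) \<and> b = (0, 1)"
proof
  assume "D a b = 1"
  then have "L (1 - fst a) (1 - fst b) + L (snd a) (snd b) = 2"
    by (simp add: D_def)
  then have "2 \<le> \<bar>fst a - fst b\<bar> + \<bar>snd a - snd b\<bar>"
    using L_le_abs_diff[of "1 - fst a" "1 - fst b"] L_le_abs_diff[of "snd a" "snd b"]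
      Theta_bounds[OF assms(1)] Theta_bounds[OF assms(2)]
    by simp
  then show "a = (0, 1) \<and> b = (1, 0) \<or> a = (1, 0) \<and> b = (0, 1)"
    using Theta_bounds[OF assms(1)] Theta_bounds[OF assms(2)]
    by (auto simp: prod_eq_iff abs_if split: if_splits)
next
  assume "a = (0, 1) \<and> b = (1, 0) \<or> a = (1, 0) \<and> b = (0, 1)"
  then show "D a b = 1" by (auto simp: D_def L_def)
qed

text \<open>Up to the factor \<open>sqrt (1 / 2)\<close>, \<open>D\<close> is the Euclidean norm of
  two quantities that each satisfy the triangle inequality; Minkowski's inequality in the plane
  combines them.\<close>

lemma D_triangle:
  assumes "a \<in> Theta" "b \<in> Theta" "c \<in> Theta"
  shows "D a c \<le> D a b + D b c"
proof -
  define x where "x = (\<lambda>(a :: real \<times> real) (b :: real \<times> real). sqrt (L (1 - fst a) (1 - fst b)))"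
  define y where "y = (\<lambda>(a :: real \<times> real) (b :: real \<times> real). sqrt (L (snd a) (snd b)))"
  note bounds = Theta_bounds[OF assms(1)] Theta_bounds[OF assms(2)] Theta_bounds[OF assms(3)]
  have D: "D u v = sqrt (1 / 2) * sqrt ((x u v)\<^sup>2 + (y u v)\<^sup>2)" if "u \<in> {a, b, c}" "v \<in> {a, b, c}" for u v
    using that bounds by (auto simp: D_def x_def y_def L_nonneg real_sqrt_mult[symmetric])
  have "sqrt ((x a c)\<^sup>2 + (y a c)\<^sup>2) \<le> sqrt ((x a b + x b c)\<^sup>2 + (y a b + y b c)\<^sup>2)"
    using bounds
    by (intro real_sqrt_le_mono add_mono power_mono) (auto simp: x_def y_def L_nonneg sqrt_L_triangle)
  also have "\<dots> \<le> sqrt ((x a b)\<^sup>2 + (y a b)\<^sup>2) + sqrt ((x b c)\<^sup>2 + (y b c)\<^sup>2)"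
    by (rule real_sqrt_sum_squares_triangle_ineq)
  finally show ?thesis
    by (simp add: D distrib_left[symmetric] mult_left_mono)
qed

text \<open>Along the chain \<open>1 - fst\<close> and \<open>snd\<close> both decrease, so both
  \<open>L\<close> terms grow as the endpoints separate. Distinct pairs differ in some coordinate,
  which makes one term strict.\<close>

lemma D_chain:
  assumes "a \<in> Theta" "b \<in> Theta" "c \<in> Theta"
    and "fst a \<le> fst b" "snd b \<le> snd a" "fst b \<le> fst c" "snd c \<le> snd b"
  shows "D a b \<le> D a c" "b \<noteq> c \<Longrightarrow> D a b < D a c" "D b c \<le> D a c" "a \<noteq> b \<Longrightarrow> D b c < D a c"
proof -
  note bounds = Theta_bounds[OF assms(1)] Theta_bounds[OF assms(2)] Theta_bounds[OF assms(3)]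
  have 1: "L (1 - fst a) (1 - fst b) \<le> L (1 - fst a) (1 - fst c)"
    "fst b \<noteq> fst c \<Longrightarrow> L (1 - fst a) (1 - fst b) < L (1 - fst a) (1 - fst c)"
    using L_less_left[of "1 - fst c" "1 - fst b" "1 - fst a"] assms(4-) bounds
    by (cases "fst b = fst c"; simp add: L_commute)+
  have 2: "L (snd a) (snd b) \<le> L (snd a) (snd c)"
    "snd b \<noteq> snd c \<Longrightarrow> L (snd a) (snd b) < L (snd a) (snd c)"
    using L_less_left[of "snd c" "snd b" "snd a"] assms(4-) bounds
    by (cases "snd b = snd c"; simp add: L_commute)+
  have 3: "L (1 - fst b) (1 - fst c) \<le> L (1 - fst a) (1 - fst c)"
    "fst a \<noteq> fst b \<Longrightarrow> L (1 - fst b) (1 - fst c) < L (1 - fst a) (1 - fst c)"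
    using L_less_right[of "1 - fst c" "1 - fst b" "1 - fst a"] assms(4-) bounds
    by (cases "fst a = fst b"; simp add: L_commute)+
  have 4: "L (snd b) (snd c) \<le> L (snd a) (snd c)"
    "snd a \<noteq> snd b \<Longrightarrow> L (snd b) (snd c) < L (snd a) (snd c)"
    using L_less_right[of "snd c" "snd b" "snd a"] assms(4-) bounds
    by (cases "snd a = snd b"; simp add: L_commute)+
  show "D a b \<le> D a c" using 1 2 by (simp add: D_def)
  show "D b c \<le> D a c" using 3 4 by (simp add: D_def)
  show "D a b < D a c" if "b \<noteq> c"
    using 1 2 that by (cases "fst b = fst c") (auto simp: D_def prod_eq_iff add_less_le_mono add_le_less_mono)
  show "D b c < D a c" if "a \<noteq> b"
    using 3 4 that by (cases "fst a = fst b") (auto simp: D_def prod_eq_iff add_less_le_mono add_le_less_mono)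
qed

section \<open>Weighted sums over \<open>X\<close>\<close>

lemma d_Wu_eq: "d_Wu X \<omega> I1 I2 = (\<Sum>x\<in>X. \<omega> x * D (I1 x) (I2 x))"
  by (simp add: d_Wu_def D_def)

lemma IFS_Theta: "I \<in> IFS X \<Longrightarrow> x \<in> X \<Longrightarrow> I x \<in> Theta"
  by (auto simp: IFS_def)

lemma IFS_eqI:
  assumes "I1 \<in> IFS X" "I2 \<in> IFS X" "\<And>x. x \<in> X \<Longrightarrow> I1 x = I2 x"
  shows "I1 = I2"
  using assms unfolding IFS_def by (rule PiE_ext)

theorem theorem3:
  fixes X :: "'a set" and \<omega> :: "'a \<Rightarrow> real"
  assumes "finite X"
    and "\<And>x. x \<in> X \<Longrightarrow> 0 < \<omega> x \<and> \<omega> x \<le> 1"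
    and "(\<Sum>x\<in>X. \<omega> x) = 1"
  shows "SIFDisM X (d_Wu X \<omega>) \<and> SIFSimM X (S_Wu X \<omega>)"
proof -
  let ?d = "d_Wu X \<omega>"
  have w: "0 < \<omega> x" if "x \<in> X" for x using assms(2) that by blast
  have nonneg: "0 \<le> ?d I1 I2" if "I1 \<in> IFS X" "I2 \<in> IFS X" for I1 I2
    unfolding d_Wu_eq using that w by (intro sum_nonneg mult_nonneg_nonneg D_nonneg) (auto intro: IFS_Theta less_imp_le)
  \<comment> \<open>Because the weights sum to 1, the complement is again a weighted sum of
    nonnegative terms; the upper bound and the case of distance 1 are then settled termwise.\<close>
  have complement: "1 - ?d I1 I2 = (\<Sum>x\<in>X. \<omega> x * (1 - D (I1 x) (I2 x)))" for I1 I2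
    by (simp add: d_Wu_eq right_diff_distrib sum_subtractf assms(3))
  have le1: "?d I1 I2 \<le> 1" if "I1 \<in> IFS X" "I2 \<in> IFS X" for I1 I2
  proof -
    have "0 \<le> 1 - ?d I1 I2"
      unfolding complement using that w
      by (intro sum_nonneg mult_nonneg_nonneg) (auto intro: IFS_Theta less_imp_le D_le_1)
    then show ?thesis by simp
  qed
  have zero: "?d I1 I2 = 0 \<longleftrightarrow> I1 = I2" if I: "I1 \<in> IFS X" "I2 \<in> IFS X" for I1 I2
  proof -
    have "?d I1 I2 = 0 \<longleftrightarrow> (\<forall>x\<in>X. \<omega> x * D (I1 x) (I2 x) = 0)"
      unfolding d_Wu_eq using I w
      by (intro sum_nonneg_eq_0_iff assms(1) mult_nonneg_nonneg D_nonneg) (auto intro: IFS_Theta less_imp_le)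
    also have "\<dots> \<longleftrightarrow> (\<forall>x\<in>X. I1 x = I2 x)"
    proof (intro ball_cong refl)
      fix x assume x: "x \<in> X"
      show "\<omega> x * D (I1 x) (I2 x) = 0 \<longleftrightarrow> I1 x = I2 x"
        using w[OF x] D_eq_0_iff[OF I[THEN IFS_Theta[OF _ x]]] by simp
    qed
    also have "\<dots> \<longleftrightarrow> I1 = I2" using I IFS_eqI by blast
    finally show ?thesis .
  qed
  have one: "1 - ?d I1 I2 = 0 \<longleftrightarrow>
      (\<forall>x\<in>X. (I1 x = (0, 1) \<and> I2 x = (1, 0)) \<or> (I1 x = (1, 0) \<and> I2 x = (0, 1)))"
    if I: "I1 \<in> IFS X" "I2 \<in> IFS X" for I1 I2
  proof -
    have "1 - ?d I1 I2 = 0 \<longleftrightarrow> (\<forall>x\<in>X. \<omega> x * (1 - D (I1 x) (I2 x)) = 0)"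
      unfolding complement using I w
      by (intro sum_nonneg_eq_0_iff assms(1) mult_nonneg_nonneg) (auto intro: IFS_Theta less_imp_le D_le_1)
    also have "\<dots> \<longleftrightarrow> (\<forall>x\<in>X. D (I1 x) (I2 x) = 1)"
      by (intro ball_cong refl) (auto dest: w)
    also have "\<dots> \<longleftrightarrow> (\<forall>x\<in>X. (I1 x = (0, 1) \<and> I2 x = (1, 0)) \<or> (I1 x = (1, 0) \<and> I2 x = (0, 1)))"
      using I by (intro ball_cong refl D_eq_1_iff IFS_Theta)
    finally show ?thesis .
  qed
  have commute: "?d I1 I2 = ?d I2 I1" for I1 I2
    by (simp add: d_Wu_eq D_commute)
  have triangle: "?d I1 I3 \<le> ?d I1 I2 + ?d I2 I3"
    if "I1 \<in> IFS X" "I2 \<in> IFS X" "I3 \<in> IFS X" for I1 I2 I3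
    unfolding d_Wu_eq sum.distrib[symmetric] distrib_left[symmetric] using that w
    by (intro sum_mono mult_left_mono D_triangle) (auto intro: IFS_Theta less_imp_le)
  have strict: "?d I1 I2 < ?d I1 I3 \<and> ?d I2 I3 < ?d I1 I3"
    if I: "I1 \<in> IFS X" "I2 \<in> IFS X" "I3 \<in> IFS X"
      and sub: "ifs_psubset X I1 I2" "ifs_psubset X I2 I3" for I1 I2 I3
  proof -
    have chain: "fst (I1 x) \<le> fst (I2 x)" "snd (I2 x) \<le> snd (I1 x)"
      "fst (I2 x) \<le> fst (I3 x)" "snd (I3 x) \<le> snd (I2 x)" if "x \<in> X" for x
      using sub that by (auto simp: ifs_psubset_def ifs_subset_def)
    \<comment> \<open>Extensionality places each difference at a point of \<open>X\<close>. There
      the weight is positive, so one strict summand makes the sum strict: \<open>y\<close> serves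
      the first comparison, \<open>x\<close> the second.\<close>
    have "I1 \<noteq> I2" "I2 \<noteq> I3" using sub by (auto simp: ifs_psubset_def)
    then obtain x y where x: "x \<in> X" "I1 x \<noteq> I2 x" and y: "y \<in> X" "I2 y \<noteq> I3 y"
      using IFS_eqI[OF I(1,2)] IFS_eqI[OF I(2,3)] by blast
    note Dc = D_chain[OF I[THEN IFS_Theta] chain]
    have "?d I1 I2 < ?d I1 I3"
      unfolding d_Wu_eq using y w Dc(1,2)
      by (intro sum_strict_mono_ex1 assms(1)) (auto intro!: bexI[of _ y] mult_left_mono mult_strict_left_mono less_imp_le[OF w])
    moreover have "?d I2 I3 < ?d I1 I3"
      unfolding d_Wu_eq using x w Dc(3,4)
      by (intro sum_strict_mono_ex1 assms(1)) (auto intro!: bexI[of _ x] mult_left_mono mult_strict_left_mono less_imp_le[OF w])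
    ultimately show ?thesis ..
  qed
  have sim: "SIFSimM X (\<lambda>I1 I2. 1 - ?d I1 I2)"
    unfolding SIFSimM_def
    using nonneg le1 zero one commute strict by (intro conjI ballI impI) auto
  have "metric_on (IFS X) ?d"
    unfolding metric_on_iff using nonneg zero commute triangle by blast
  with sim nonneg le1 show ?thesis
    by (simp add: SIFDisM_def S_Wu_def[abs_def])
qed

end
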